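(* Let $u,v\in H^p(\Omega_s)$ with $\langle u,v\rangle_{L^2}>0$. There is a range of values of the flux-reconstruction parameter $c$, namely an interval $[0,c_0]$ with $c_0>0$ (which may depend on $u,v$), such that for every $c$ in this range the inner product in the broken Sobolev space satisfies $$\langle u,v\rangle_{H^k_c}\ \ge\ \langle u,v\rangle_{L^2}-c\,\|D^pu\|_{L^2}\,\|D^pv\|_{L^2}\ \ge\ 0 .$$
   Context: $\Omega_s$ is the (bounded, one-dimensional) spatial domain with coordinate $\xi$, $p\ge1$ is the polynomial degree of the scheme, and $D^p=\partial^p/\partial\xi^p$. The broken Sobolev inner product retains only the zeroth and $p$-th derivative terms (here $k=p$), the latter weighted by $c$: $$\langle u,v\rangle_{H^k_c}=\langle u,v\rangle_{L^2(\Omega_s)}+c\,\langle D^pu,D^pv\rangle_{L^2(\Omega_s)} .$$ *)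

theory Defs
  imports "HOL-Analysis.Analysis"
begin

text \<open>
  Functions are representatives: elements of \<open>L\<^sup>2\<close> are honest functions, not classes modulo
  almost-everywhere equality. Only their values on the domain matter.
\<close>

definition L2 :: "real set \<Rightarrow> (real \<Rightarrow> real) set" where
  "L2 \<Omega> = {f \<in> borel_measurable (lebesgue_on \<Omega>). integrable (lebesgue_on \<Omega>) (\<lambda>x. (f x)\<^sup>2)}"

definition L2_inner :: "real set \<Rightarrow> (real \<Rightarrow> real) \<Rightarrow> (real \<Rightarrow> real) \<Rightarrow> real" where
  "L2_inner \<Omega> f g = (\<integral>x. f x * g x \<partial>lebesgue_on \<Omega>)"

definition L2_nrm :: "real set \<Rightarrow> (real \<Rightarrow> real) \<Rightarrow> real" where
  "L2_nrm \<Omega> f = sqrt (L2_inner \<Omega> f f)"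

definition test_functions :: "real set \<Rightarrow> (real \<Rightarrow> real) set" where
  "test_functions \<Omega> = {\<phi>. (\<forall>k x. (deriv ^^ k) \<phi> field_differentiable at x) \<and>
     compact (closure {x. \<phi> x \<noteq> 0}) \<and> closure {x. \<phi> x \<noteq> 0} \<subseteq> \<Omega>}"

definition locally_integrable :: "real set \<Rightarrow> (real \<Rightarrow> real) \<Rightarrow> bool" where
  "locally_integrable \<Omega> f \<longleftrightarrow> (\<forall>K. compact K \<and> K \<subseteq> \<Omega> \<longrightarrow> integrable (lebesgue_on K) f)"

definition has_weak_deriv :: "real set \<Rightarrow> nat \<Rightarrow> (real \<Rightarrow> real) \<Rightarrow> (real \<Rightarrow> real) \<Rightarrow> bool" where
  "has_weak_deriv \<Omega> k u g \<longleftrightarrow> locally_integrable \<Omega> u \<and> locally_integrable \<Omega> g \<and>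
     (\<forall>\<phi>\<in>test_functions \<Omega>.
        (\<integral>x. u x * (deriv ^^ k) \<phi> x \<partial>lebesgue_on \<Omega>)
          = (-1) ^ k * (\<integral>x. g x * \<phi> x \<partial>lebesgue_on \<Omega>))"

definition sobolev_H :: "real set \<Rightarrow> nat \<Rightarrow> (real \<Rightarrow> real) set" where
  "sobolev_H \<Omega> p = {u \<in> L2 \<Omega>. \<forall>k\<le>p. \<exists>g\<in>L2 \<Omega>. has_weak_deriv \<Omega> k u g}"

text \<open>
  A chosen square-integrable representative of the weak derivative \<open>D\<^sup>k u\<close>. On an open set weak
  derivatives are unique almost everywhere, so inner products and norms do not depend on the
  choice. The value is only meaningful if such a derivative exists, as for
  \<open>u \<in> sobolev_H \<Omega> p\<close> and \<open>k \<le> p\<close>.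
\<close>

definition weak_deriv :: "real set \<Rightarrow> nat \<Rightarrow> (real \<Rightarrow> real) \<Rightarrow> real \<Rightarrow> real" where
  "weak_deriv \<Omega> k u = (SOME g. g \<in> L2 \<Omega> \<and> has_weak_deriv \<Omega> k u g)"

definition broken_sobolev_inner ::
    "real set \<Rightarrow> nat \<Rightarrow> real \<Rightarrow> (real \<Rightarrow> real) \<Rightarrow> (real \<Rightarrow> real) \<Rightarrow> real" where
  "broken_sobolev_inner \<Omega> p c u v =
     L2_inner \<Omega> u v + c * L2_inner \<Omega> (weak_deriv \<Omega> p u) (weak_deriv \<Omega> p v)"

end

theory Submission
  imports Defs
begin

text \<open>
  Since the \<open>p\<close>-th weak derivatives of \<open>u\<close> and \<open>v\<close> are square integrable, Cauchy--Schwarz bounds their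
  inner product below by minus the product \<open>N\<close> of their norms (lemmas \<open>weak_deriv_in_L2\<close> and
  \<open>L2_Cauchy_Schwarz\<close>); multiplying by \<open>c \<ge> 0\<close> gives the first inequality. The second one says \<open>c * N \<le> \<langle>u, v\<rangle>\<close>, which holds for all small \<open>c\<close> because
  \<open>\<langle>u, v\<rangle> > 0\<close>.
\<close>

text \<open>
  The pointwise bound \<open>\<bar>a * b\<bar> \<le> a\<^sup>2 + b\<^sup>2\<close> puts the product of two functions in \<open>L\<^sup>2\<close> in \<open>L\<^sup>1\<close>, so that
  the inner product can be expanded bilinearly.
\<close>

lemma integrable_mult_L2:
  assumes "f \<in> L2 \<Omega>" and "g \<in> L2 \<Omega>"
  shows "integrable (lebesgue_on \<Omega>) (\<lambda>x. f x * g x)"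
proof (rule Bochner_Integration.integrable_bound)
  show "integrable (lebesgue_on \<Omega>) (\<lambda>x. (f x)\<^sup>2 + (g x)\<^sup>2)"
    using assms by (auto simp: L2_def)
  show "(\<lambda>x. f x * g x) \<in> borel_measurable (lebesgue_on \<Omega>)"
    using assms by (auto simp: L2_def)
  have "\<bar>a * b\<bar> \<le> a\<^sup>2 + b\<^sup>2" for a b :: real
  proof -
    have "0 \<le> (\<bar>a\<bar> - \<bar>b\<bar>)\<^sup>2" "0 \<le> \<bar>a\<bar> * \<bar>b\<bar>"
      by auto
    then show ?thesis
      unfolding abs_mult power2_diff power2_abs by linarith
  qed
  then show "AE x in lebesgue_on \<Omega>. norm (f x * g x) \<le> norm ((f x)\<^sup>2 + (g x)\<^sup>2)"
    by (auto intro: order_trans)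
qed

lemma L2_inner_self_nonneg: "0 \<le> L2_inner \<Omega> f f"
  by (simp add: L2_inner_def)

text \<open>
  The quadratic form \<open>\<parallel>s f + t g\<parallel>\<^sup>2\<close> in \<open>(s, t)\<close> is nonnegative, so its determinant
  \<open>\<parallel>f\<parallel>\<^sup>2 \<parallel>g\<parallel>\<^sup>2 - \<langle>f, g\<rangle>\<^sup>2\<close> is nonnegative. Keeping both variables treats \<open>f\<close> and \<open>g\<close> alike and
  isolates the degenerate case in which both norms vanish.
\<close>

lemma L2_Cauchy_Schwarz:
  assumes "f \<in> L2 \<Omega>" and "g \<in> L2 \<Omega>"
  shows "\<bar>L2_inner \<Omega> f g\<bar> \<le> L2_nrm \<Omega> f * L2_nrm \<Omega> g"
proof -
  let ?A = "L2_inner \<Omega> f f" and ?B = "L2_inner \<Omega> f g" and ?C = "L2_inner \<Omega> g g"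
  note int = integrable_mult_L2[OF assms(1,1)] integrable_mult_L2[OF assms]
    integrable_mult_L2[OF assms(2,2)]
  have quadratic: "0 \<le> s\<^sup>2 * ?A + 2 * s * t * ?B + t\<^sup>2 * ?C" for s t :: real
  proof -
    have "0 \<le> (\<integral>x. (s * f x + t * g x)\<^sup>2 \<partial>lebesgue_on \<Omega>)"
      by simp
    also have "\<dots> = (\<integral>x. s\<^sup>2 * (f x * f x) + 2 * s * t * (f x * g x) + t\<^sup>2 * (g x * g x)
        \<partial>lebesgue_on \<Omega>)"
      by (rule Bochner_Integration.integral_cong) (auto simp: power2_eq_square algebra_simps)
    also have "\<dots> = s\<^sup>2 * ?A + 2 * s * t * ?B + t\<^sup>2 * ?C"
      using int by (simp add: L2_inner_def)
    finally show ?thesis .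
  qed
  have "?B\<^sup>2 \<le> ?A * ?C"
  proof (rule ccontr)
    assume "\<not> ?B\<^sup>2 \<le> ?A * ?C"
    then have neg: "?A * ?C - ?B\<^sup>2 < 0"
      by simp
    \<comment> \<open>At these two points the form is a diagonal coefficient times the determinant.\<close>
    have "0 \<le> ?C * (?A * ?C - ?B\<^sup>2)" "0 \<le> ?A * (?A * ?C - ?B\<^sup>2)"
      using quadratic[of ?C "- ?B"] quadratic[of "- ?B" ?A]
      by (simp_all add: power2_eq_square algebra_simps)
    with neg have "?C \<le> 0" "?A \<le> 0"
      by (auto simp: zero_le_mult_iff)
    then have zero: "?A = 0" "?C = 0"
      using L2_inner_self_nonneg[of \<Omega> f] L2_inner_self_nonneg[of \<Omega> g] by linarith+
    have "?B\<^sup>2 \<le> 0"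
      using quadratic[of 1 "- ?B"] unfolding zero by (simp add: power2_eq_square)
    with neg show False
      unfolding zero by simp
  qed
  then have "sqrt (?B\<^sup>2) \<le> sqrt (?A * ?C)"
    by (rule real_sqrt_le_mono)
  then show ?thesis
    by (simp add: L2_nrm_def real_sqrt_mult)
qed

lemma weak_deriv_in_L2:
  assumes "u \<in> sobolev_H \<Omega> p" and "k \<le> p"
  shows "weak_deriv \<Omega> k u \<in> L2 \<Omega>"
proof -
  have "\<exists>g. g \<in> L2 \<Omega> \<and> has_weak_deriv \<Omega> k u g"
    using assms by (auto simp: sobolev_H_def)
  then show ?thesis
    unfolding weak_deriv_def by (rule someI2_ex) simp
qed

theorem theorem6:
  fixes \<Omega> :: "real set" and p :: nat and u v :: "real \<Rightarrow> real"
  assumes "open \<Omega>" and "bounded \<Omega>"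
    and "p \<ge> 1"
    and "u \<in> sobolev_H \<Omega> p" and "v \<in> sobolev_H \<Omega> p"
    and "L2_inner \<Omega> u v > 0"
  shows "\<exists>c\<^sub>0>0. \<forall>c\<in>{0..c\<^sub>0}.
           broken_sobolev_inner \<Omega> p c u v
             \<ge> L2_inner \<Omega> u v - c * L2_nrm \<Omega> (weak_deriv \<Omega> p u) * L2_nrm \<Omega> (weak_deriv \<Omega> p v)
         \<and> L2_inner \<Omega> u v - c * L2_nrm \<Omega> (weak_deriv \<Omega> p u) * L2_nrm \<Omega> (weak_deriv \<Omega> p v) \<ge> 0"
proof -
  let ?a = "L2_inner \<Omega> u v" and ?Du = "weak_deriv \<Omega> p u" and ?Dv = "weak_deriv \<Omega> p v"
  define N where "N = L2_nrm \<Omega> ?Du * L2_nrm \<Omega> ?Dv"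
  have "\<bar>L2_inner \<Omega> ?Du ?Dv\<bar> \<le> N"
    unfolding N_def using assms by (intro L2_Cauchy_Schwarz weak_deriv_in_L2[of _ _ p]) auto
  then have lower: "- N \<le> L2_inner \<Omega> ?Du ?Dv" and N: "0 \<le> N"
    by linarith+
  \<comment> \<open>The \<open>1\<close> in the denominator covers \<open>N = 0\<close>, where every \<open>c\<close> is admissible.\<close>
  define c\<^sub>0 where "c\<^sub>0 = ?a / (N + 1)"
  have "c\<^sub>0 > 0"
    using assms(6) N by (simp add: c\<^sub>0_def)
  moreover have "broken_sobolev_inner \<Omega> p c u v \<ge> ?a - c * N \<and> ?a - c * N \<ge> 0"
    if c: "c \<in> {0..c\<^sub>0}" for c
  proof
    show "broken_sobolev_inner \<Omega> p c u v \<ge> ?a - c * N"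
      using mult_left_mono[OF lower, of c] c by (simp add: broken_sobolev_inner_def)
    have "c * N \<le> c * (N + 1)"
      using c by (intro mult_left_mono) auto
    also have "\<dots> \<le> c\<^sub>0 * (N + 1)"
      using c N by (intro mult_right_mono) auto
    also have "\<dots> = ?a"
      using N by (simp add: c\<^sub>0_def)
    finally show "?a - c * N \<ge> 0"
      by simp
  qed
  ultimately show ?thesis
    unfolding N_def by (auto simp: mult.assoc)
qed

end
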